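(* Let $\beta\ge 0$. The following three conditions are equivalent: (i) $|E_{1,\beta}(z)|\ge E_{1,\beta}(\Re z)$ for all $z\in\mathbb{C}$; (ii) $\beta\le 1$; (iii) the function $x\mapsto 1/E_{1,\beta}(x)$ is completely monotone on $(0,\infty)$.
   Context: For $\beta\in\mathbb{R}$, $E_{1,\beta}$ is the Mittag-Leffler function $E_{1,\beta}(z)=\sum_{k=0}^{\infty}\frac{z^k}{\Gamma(k+\beta)}$, $z\in\mathbb{C}$, with the convention $1/\Gamma(s)=0$ at the poles $s=0,-1,-2,\dots$ of $\Gamma$. $\Re z$ denotes the real part of $z$. A smooth function $f:(0,\infty)\to(0,\infty)$ is completely monotone (CM) if $(-1)^n f^{(n)}(x)\ge 0$ for all integers $n\ge 0$ and all $x>0$. *)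

theory Defs
  imports "HOL-Analysis.Analysis"
begin

text \<open>The reciprocal Gamma function \<^const>\<open>rGamma\<close> vanishes at \<open>0, -1, -2, \<dots>\<close>, so this includes the
  convention \<open>1/\<Gamma>(s) = 0\<close> at the poles. The scaling by a real coefficient lets the same series
  serve for real and for complex arguments.\<close>

definition mittag_leffler_1 :: "real \<Rightarrow> 'a::{real_normed_algebra_1, banach} \<Rightarrow> 'a" where
  "mittag_leffler_1 \<beta> z = (\<Sum>k. rGamma (real k + \<beta>) *\<^sub>R z ^ k)"

text \<open>Only the values on \<open>(0, \<infinity>)\<close> matter: as this set is open, the iterated derivatives
  at \<open>x > 0\<close> depend only on \<open>f\<close> near \<open>x\<close>. The second condition is smoothness; it is needed
  because \<^const>\<open>deriv\<close> is total.\<close>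

definition completely_monotone :: "(real \<Rightarrow> real) \<Rightarrow> bool" where
  "completely_monotone f \<longleftrightarrow>
     (\<forall>x>0. f x > 0) \<and>
     (\<forall>n. \<forall>x>0. (deriv ^^ n) f differentiable (at x)) \<and>
     (\<forall>n. \<forall>x>0. (-1) ^ n * (deriv ^^ n) f x \<ge> 0)"

end

theory Submission
  imports Defs "HOL-Complex_Analysis.Complex_Analysis" "HOL-Real_Asymp.Real_Asymp"
begin

text \<open>Write \<open>E = E\<^sub>1\<^sub>,\<^sub>\<beta>\<close>, \<open>V = E\<^sub>1\<^sub>,\<^sub>\<beta>\<^sub>+\<^sub>1\<close>, \<open>r = 1 / \<Gamma>(\<beta>)\<close> and \<open>a = 1 - \<beta>\<close>. Everything rests on
  \<open>E = r + z V\<close> and \<open>E' = E + a V\<close>.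

  For \<open>\<beta> \<le> 1\<close>, the first-order equation along rays gives (i): the derivative of
  \<open>u\<^sup>-\<^sup>a exp (- u z) E (u z)\<close> with respect to \<open>u\<close> has a modulus that depends only on \<open>u\<close> and \<open>Re z\<close>. For (iii), put
  \<open>F = 1 / E\<close> and \<open>N = V / E\<close>, so that \<open>- F' = F + a F N\<close> and \<open>z N = 1 - r F\<close>. Differentiating, the sign
  of the next derivative of \<open>F\<close> at \<open>x\<close> is determined by its values on \<open>[0, x)\<close>, and an induction on the
  order, started at \<open>0\<close>, yields complete monotonicity.

  For \<open>\<beta> > 1\<close>, \<open>log E\<close> is strictly convex at \<open>0\<close>, so \<open>|E|\<close> has a strict local maximum at \<open>0\<close> along the
  imaginary axis and (i) fails. If \<open>F\<close> were completely monotone, then the same equations would make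
  \<open>F(-s)\<close> an entire series with nonnegative coefficients and at most linear growth, but its
  coefficient of \<open>s\<^sup>2\<close> is positive.\<close>

section \<open>The power series: convergence, shift in \<beta>, derivative, positivity\<close>

lemma rGamma_Suc_shift:
  assumes "\<beta> \<ge> 0"
  shows "(real k + \<beta>) * rGamma (real (Suc k) + \<beta>) = rGamma (real k + \<beta>)"
  using rGamma_plus1[of "real k + \<beta>"] by (simp add: add_ac)

text \<open>Ratio test: by the functional equation, consecutive terms differ in norm by the factor
  \<open>norm z / (n + \<beta>)\<close>, which is at most \<open>1/2\<close> once
  \<open>n \<ge> 2 * norm z\<close> and \<open>n > 0\<close>.\<close>

lemma mittag_leffler_1_abs_summable:
  fixes z :: "'a::{real_normed_field, banach}"
  assumes "\<beta> \<ge> 0"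
  shows "summable (\<lambda>k. norm (of_real (rGamma (real k + \<beta>)) * z ^ k))"
proof (rule summable_ratio_test)
  show "(1/2 :: real) < 1" by simp
next
  fix n :: nat
  assume n: "nat \<lceil>2 * norm z\<rceil> + 1 \<le> n"
  hence n': "2 * norm z \<le> real n" "n > 0" by linarith+
  have pos: "real n + \<beta> > 0" using n' assms by simp
  have eq: "\<bar>rGamma (real n + \<beta>)\<bar> = (real n + \<beta>) * \<bar>rGamma (real (Suc n) + \<beta>)\<bar>"
    using rGamma_Suc_shift[OF assms, of n] pos by (metis abs_mult abs_of_pos)
  have "norm z \<le> (real n + \<beta>) / 2" using n' assms by simp
  hence "\<bar>rGamma (real (Suc n) + \<beta>)\<bar> * norm z * norm z ^ n
      \<le> \<bar>rGamma (real (Suc n) + \<beta>)\<bar> * ((real n + \<beta>) / 2) * norm z ^ n"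
    by (intro mult_right_mono mult_left_mono) auto
  thus "norm (norm (of_real (rGamma (real (Suc n) + \<beta>)) * z ^ Suc n))
      \<le> 1/2 * norm (norm (of_real (rGamma (real n + \<beta>)) * z ^ n))"
    using pos by (simp add: norm_mult norm_power eq mult_ac)
qed

lemma mittag_leffler_1_sums:
  fixes z :: "'a::{real_normed_field, banach}"
  assumes "\<beta> \<ge> 0"
  shows "(\<lambda>k. of_real (rGamma (real k + \<beta>)) * z ^ k) sums mittag_leffler_1 \<beta> z"
  unfolding mittag_leffler_1_def scaleR_conv_of_real
  by (rule summable_sums[OF summable_norm_cancel[OF mittag_leffler_1_abs_summable[OF assms]]])

lemma mittag_leffler_1_shift:
  fixes z :: "'a::{real_normed_field, banach}"
  assumes "\<beta> \<ge> 0"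
  shows "mittag_leffler_1 \<beta> z = of_real (rGamma \<beta>) + z * mittag_leffler_1 (\<beta> + 1) z"
proof -
  have "(\<lambda>k. z * (of_real (rGamma (real k + (\<beta> + 1))) * z ^ k)) sums (z * mittag_leffler_1 (\<beta> + 1) z)"
    by (intro sums_mult mittag_leffler_1_sums) (use assms in simp)
  hence "(\<lambda>k. of_real (rGamma (real (Suc k) + \<beta>)) * z ^ Suc k) sums (z * mittag_leffler_1 (\<beta> + 1) z)"
    by (simp add: mult_ac add_ac)
  hence "(\<lambda>k. of_real (rGamma (real k + \<beta>)) * z ^ k) sums
      (z * mittag_leffler_1 (\<beta> + 1) z + of_real (rGamma (real 0 + \<beta>)) * z ^ 0)"
    by (subst (asm) sums_Suc_iff) auto
  thus ?thesis
    using sums_unique2[OF mittag_leffler_1_sums[OF assms, of z]] by (simp add: add_ac)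
qed

text \<open>The constant term \<open>rGamma 0\<close> vanishes and \<open>V\<close> is the
  exponential. Since this function is zero at the origin, arguments that start at \<open>0\<close>
  exclude \<beta> = 0, which is treated by this closed form.\<close>

lemma mittag_leffler_1_0:
  fixes z :: "'a::{real_normed_field, banach}"
  shows "mittag_leffler_1 0 z = z * exp z"
proof -
  have "rGamma (real k + 1) = inverse (fact k)" for k
    by (metis Gamma_fact add.commute rGamma_inverse_Gamma)
  hence "mittag_leffler_1 1 z = exp z"
    by (simp add: mittag_leffler_1_def exp_def)
  thus ?thesis using mittag_leffler_1_shift[of 0 z] by simp
qed

text \<open>The factor \<open>k + 1\<close> from termwise differentiation splits as
  \<open>(k + \<beta>) + (1 - \<beta>)\<close>; the functional equation turns the first part into
  the coefficient of \<open>E\<close> itself.\<close>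

lemma has_field_derivative_mittag_leffler_1:
  fixes z :: "'a::{real_normed_field, banach}"
  assumes "\<beta> \<ge> 0"
  shows "(mittag_leffler_1 \<beta> has_field_derivative
    (mittag_leffler_1 \<beta> z + of_real (1 - \<beta>) * mittag_leffler_1 (\<beta> + 1) z)) (at z)"
proof -
  define c :: "nat \<Rightarrow> 'a" where "c = (\<lambda>k. of_real (rGamma (real k + \<beta>)))"
  have c_sums: "(\<lambda>k. c k * x ^ k) sums mittag_leffler_1 \<beta> x" for x
    unfolding c_def by (rule mittag_leffler_1_sums[OF assms])
  have "((\<lambda>x. \<Sum>k. c k * x ^ k) has_field_derivative (\<Sum>k. diffs c k * z ^ k)) (at z)"
    by (intro termdiffs_strong_converges_everywhere) (use c_sums sums_summable in blast)
  moreover have "(\<lambda>x. \<Sum>k. c k * x ^ k) = mittag_leffler_1 \<beta>"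
    using sums_unique[OF c_sums] by (simp add: fun_eq_iff)
  moreover have "(\<lambda>k. diffs c k * z ^ k) sums
      (mittag_leffler_1 \<beta> z + of_real (1 - \<beta>) * mittag_leffler_1 (\<beta> + 1) z)"
  proof -
    have "diffs c k = c k + of_real (1 - \<beta>) * of_real (rGamma (real k + (\<beta> + 1)))" for k
    proof -
      have "diffs c k = of_real (real (Suc k) * rGamma (real (Suc k) + \<beta>))"
        by (simp add: diffs_def c_def)
      also have "real (Suc k) * rGamma (real (Suc k) + \<beta>) =
          rGamma (real k + \<beta>) + (1 - \<beta>) * rGamma (real k + (\<beta> + 1))"
        unfolding rGamma_Suc_shift[OF assms, of k, symmetric] by (simp add: algebra_simps)
      finally show ?thesis by (simp add: c_def)
    qed
    hence "(\<lambda>k. diffs c k * z ^ k) = (\<lambda>k. c k * z ^ k +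
        of_real (1 - \<beta>) * (of_real (rGamma (real k + (\<beta> + 1))) * z ^ k))"
      by (simp add: distrib_right mult.assoc)
    thus ?thesis
      using assms by (simp only:) (intro sums_add sums_mult c_sums mittag_leffler_1_sums, simp)
  qed
  ultimately show ?thesis by (simp add: sums_iff)
qed

lemma mittag_leffler_1_of_real:
  assumes "\<beta> \<ge> 0"
  shows "mittag_leffler_1 \<beta> (complex_of_real x) = of_real (mittag_leffler_1 \<beta> x)"
proof -
  have "(\<lambda>k. complex_of_real (of_real (rGamma (real k + \<beta>)) * x ^ k)) sums of_real (mittag_leffler_1 \<beta> x)"
    by (intro sums_of_real mittag_leffler_1_sums assms)
  thus ?thesis
    using mittag_leffler_1_sums[OF assms, of "complex_of_real x"] by (simp add: sums_unique2)
qed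

lemma rGamma_real_pos: "x > 0 \<Longrightarrow> rGamma x > (0::real)"
  using Gamma_real_pos[of x] by (simp add: rGamma_inverse_Gamma)

text \<open>The constant term alone is positive and the other terms are nonnegative, so
  \<open>x = 0\<close> is included.\<close>

lemma mittag_leffler_1_pos:
  assumes "\<beta> > 0" "x \<ge> (0::real)"
  shows "mittag_leffler_1 \<beta> x > 0"
proof -
  have "0 < rGamma \<beta>" using assms by (intro rGamma_real_pos)
  also have "rGamma \<beta> = (\<Sum>k<1. of_real (rGamma (real k + \<beta>)) * x ^ k)" by simp
  also have "\<dots> \<le> mittag_leffler_1 \<beta> x"
    unfolding sums_unique[OF mittag_leffler_1_sums[OF less_imp_le[OF assms(1)], of x]]
    using assms
    by (intro sum_le_suminf sums_summable[OF mittag_leffler_1_sums])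
       (auto intro!: mult_nonneg_nonneg less_imp_le[OF rGamma_real_pos])
  finally show ?thesis .
qed

subsection \<open>The modulus on vertical lines\<close>

text \<open>Integrating factors: \<open>exp (- u z)\<close> removes \<open>E\<close> from
  \<open>E' = E + a V\<close>, and the power of \<open>u\<close> cancels the remaining
  \<open>V\<close> by \<open>E = r + u z V\<close>. The general field serves both the ray through
  \<open>z\<close> and the one through \<open>Re z\<close>.\<close>

lemma has_vector_derivative_mittag_leffler_1_ray:
  fixes z :: "'a::{real_normed_field, banach}"
  assumes "\<beta> \<ge> 0" "u > 0"
  shows "((\<lambda>u. (u powr (\<beta> - 1)) *\<^sub>R (exp (- (u *\<^sub>R z)) * mittag_leffler_1 \<beta> (u *\<^sub>R z)))
     has_vector_derivative
       (- ((1 - \<beta>) * rGamma \<beta> * u powr (\<beta> - 2))) *\<^sub>R exp (- (u *\<^sub>R z))) (at u)"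
proof -
  let ?e = "mittag_leffler_1 \<beta> :: 'a \<Rightarrow> 'a" and ?v = "mittag_leffler_1 (\<beta> + 1) (u *\<^sub>R z)"
  have ray: "((\<lambda>u. u *\<^sub>R z) has_vector_derivative z) (at u)"
    by (auto intro!: derivative_eq_intros)
  have d1: "((\<lambda>w. exp (- w) * ?e w) has_field_derivative
       exp (- (u *\<^sub>R z)) * of_real (1 - \<beta>) * ?v) (at (u *\<^sub>R z))"
    by (rule DERIV_cong[OF DERIV_mult[OF DERIV_chain2[OF DERIV_exp DERIV_minus[OF DERIV_ident]]
          has_field_derivative_mittag_leffler_1[OF assms(1)]]]) (simp add: algebra_simps)
  have d2: "((\<lambda>u. exp (- (u *\<^sub>R z)) * ?e (u *\<^sub>R z)) has_vector_derivative
       z * (exp (- (u *\<^sub>R z)) * of_real (1 - \<beta>) * ?v)) (at u)"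
    using field_vector_diff_chain_at[OF ray d1] by (simp add: o_def)
  have d3: "((\<lambda>u. u powr (\<beta> - 1)) has_field_derivative (\<beta> - 1) * u powr (\<beta> - 2)) (at u)"
    using has_real_derivative_powr[OF assms(2), of "\<beta> - 1"] by simp
  have p: "u powr (\<beta> - 1) = u * u powr (\<beta> - 2)"
    using assms powr_mult_base[of u "\<beta> - 2"] by simp
  have shift: "?e (u *\<^sub>R z) = of_real (rGamma \<beta>) + of_real u * z * ?v"
    using mittag_leffler_1_shift[OF assms(1), of "u *\<^sub>R z"] by (simp add: scaleR_conv_of_real)
  show ?thesis
    by (rule has_vector_derivative_eq_rhs[OF has_vector_derivative_scaleR[OF d3 d2]])
       (unfold shift p, simp add: scaleR_conv_of_real algebra_simps)
qed

lemma isCont_mittag_leffler_1 [continuous_intros]: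
  fixes f :: "'b::t2_space \<Rightarrow> 'a::{real_normed_field, banach}"
  assumes "\<beta> \<ge> 0" "isCont f x"
  shows "isCont (\<lambda>x. mittag_leffler_1 \<beta> (f x)) x"
  by (rule isCont_o2[OF assms(2) DERIV_isCont[OF has_field_derivative_mittag_leffler_1[OF assms(1)]]])

text \<open>Below, \<open>|W'| = - Q'\<close>, so \<open>|W| - Q\<close> is nondecreasing, and it vanishes in the limit \<open>u \<rightarrow> 0\<close>.
  Zeros of \<open>E\<close> need no separate treatment.\<close>

lemma mittag_leffler_1_Re_le_cmod:
  fixes z :: complex
  assumes "0 < \<beta>" "\<beta> \<le> 1"
  shows "mittag_leffler_1 \<beta> (Re z) \<le> cmod (mittag_leffler_1 \<beta> z)"
proof -
  have \<beta>: "\<beta> \<ge> 0" using assms by simp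
  define x where "x = Re z"
  define W where "W = (\<lambda>u::real. (u powr (\<beta> - 1)) *\<^sub>R (exp (- (u *\<^sub>R z)) * mittag_leffler_1 \<beta> (u *\<^sub>R z)))"
  define Q where "Q = (\<lambda>u::real. (u powr (\<beta> - 1)) *\<^sub>R (exp (- (u *\<^sub>R x)) * mittag_leffler_1 \<beta> (u *\<^sub>R x)))"
  \<comment> \<open>\<open>B u\<close> bounds \<open>Q u - cmod (W u)\<close>: in the difference of
    the two values of \<open>E\<close> the constant terms cancel, and the factor \<open>u\<close>
    gained raises the exponent from \<open>\<beta> - 1\<close> to \<open>\<beta> > 0\<close>, so
    that \<open>B\<close> tends to \<open>0\<close>.\<close>
  define B where "B = (\<lambda>u::real. u powr \<beta> * (exp (- (u * x)) *
    cmod (of_real x * mittag_leffler_1 (\<beta> + 1) (of_real u * of_real x) - z * mittag_leffler_1 (\<beta> + 1) (of_real u * z))))"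
  define c where "c = (1 - \<beta>) * rGamma \<beta>"
  have c: "c \<ge> 0" using assms by (simp add: c_def less_imp_le[OF rGamma_real_pos])
  have W': "(W has_vector_derivative (- (c * u powr (\<beta> - 2))) *\<^sub>R exp (- (u *\<^sub>R z))) (at u)" if "u > 0" for u
    unfolding W_def c_def by (rule has_vector_derivative_mittag_leffler_1_ray[OF \<beta> that])
  have Q': "(Q has_vector_derivative (- (c * u powr (\<beta> - 2))) *\<^sub>R exp (- (u *\<^sub>R x))) (at u)" if "u > 0" for u
    unfolding Q_def c_def by (rule has_vector_derivative_mittag_leffler_1_ray[OF \<beta> that])
  have bound: "Q 1 - cmod (W 1) \<le> B u" if u: "0 < u" "u < 1" for u
  proof -
    have "norm (W 1 - W u) \<le> - Q 1 - (- Q u)"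
    proof (rule differentiable_bound_general[OF u(2)])
      show "continuous_on {u..1} W" "continuous_on {u..1} (\<lambda>u. - Q u)"
        using u by (auto intro!: continuous_at_imp_continuous_on continuous_intros
              has_vector_derivative_continuous[OF W'] has_vector_derivative_continuous[OF Q'])
    next
      fix t assume t: "u < t" "t < 1"
      show "(W has_vector_derivative (- (c * t powr (\<beta> - 2))) *\<^sub>R exp (- (t *\<^sub>R z))) (at t)"
        using t u by (intro W') simp
      show "((\<lambda>u. - Q u) has_vector_derivative - ((- (c * t powr (\<beta> - 2))) *\<^sub>R exp (- (t *\<^sub>R x)))) (at t)"
        using t u by (intro has_vector_derivative_minus Q') simp
      show "norm ((- (c * t powr (\<beta> - 2))) *\<^sub>R exp (- (t *\<^sub>R z))) \<le> - ((- (c * t powr (\<beta> - 2))) *\<^sub>R exp (- (t *\<^sub>R x)))"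
        using c by (simp add: abs_mult x_def)
    qed
    hence "Q 1 - cmod (W 1) \<le> Q u - cmod (W u)"
      using norm_triangle_ineq2[of "W u" "W 1"] by (simp add: norm_minus_commute)
    also have "\<dots> = u powr (\<beta> - 1) * exp (- (u * x)) * (mittag_leffler_1 \<beta> (u * x) - cmod (mittag_leffler_1 \<beta> (of_real u * z)))"
      by (simp add: Q_def W_def norm_mult x_def scaleR_conv_of_real right_diff_distrib)
    also have "\<dots> \<le> u powr (\<beta> - 1) * exp (- (u * x)) * cmod (mittag_leffler_1 \<beta> (of_real u * of_real x) - mittag_leffler_1 \<beta> (of_real u * z))"
    proof (intro mult_left_mono)
      have "mittag_leffler_1 \<beta> (u * x) \<le> cmod (mittag_leffler_1 \<beta> (of_real (u * x)))"
        by (simp only: mittag_leffler_1_of_real[OF \<beta>] norm_of_real)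
      thus "mittag_leffler_1 \<beta> (u * x) - cmod (mittag_leffler_1 \<beta> (of_real u * z))
          \<le> cmod (mittag_leffler_1 \<beta> (of_real u * of_real x) - mittag_leffler_1 \<beta> (of_real u * z))"
        using norm_triangle_ineq2[of "mittag_leffler_1 \<beta> (of_real u * of_real x)" "mittag_leffler_1 \<beta> (of_real u * z)"]
        by simp
    qed simp
    also have "mittag_leffler_1 \<beta> (of_real u * of_real x) - mittag_leffler_1 \<beta> (of_real u * z) =
       of_real u * (of_real x * mittag_leffler_1 (\<beta> + 1) (of_real u * of_real x) - z * mittag_leffler_1 (\<beta> + 1) (of_real u * z))"
      unfolding mittag_leffler_1_shift[OF \<beta>, of "of_real u * of_real x"] mittag_leffler_1_shift[OF \<beta>, of "of_real u * z"]
      by (simp add: algebra_simps)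
    also have "u powr (\<beta> - 1) * exp (- (u * x)) * cmod \<dots> = B u"
      using u powr_mult_base[of u "\<beta> - 1"] by (simp add: B_def norm_mult mult_ac)
    finally show ?thesis .
  qed
  have "((\<lambda>u. u powr \<beta>) \<longlongrightarrow> 0) (at_right 0)"
    using assms by real_asymp
  moreover have "isCont (\<lambda>u. exp (- (u * x)) *
    cmod (of_real x * mittag_leffler_1 (\<beta> + 1) (of_real u * of_real x) - z * mittag_leffler_1 (\<beta> + 1) (of_real u * z))) 0"
    using \<beta> by (intro continuous_intros) auto
  ultimately have "(B \<longlongrightarrow> 0) (at_right 0)"
    unfolding B_def isCont_def
    using tendsto_mult[OF _ tendsto_mono[OF at_le[OF subset_UNIV]]] by fastforce
  moreover have "\<forall>\<^sub>F u in at_right 0. Q 1 - cmod (W 1) \<le> B u"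
    using eventually_at_right_real[of 0 1] bound by (auto elim: eventually_mono)
  ultimately have "Q 1 - cmod (W 1) \<le> 0"
    by (intro tendsto_lowerbound) auto
  \<comment> \<open>At \<open>u = 1\<close> both terms carry the positive factor
    \<open>exp (- x)\<close>.\<close>
  thus ?thesis by (simp add: Q_def W_def norm_mult x_def mult_le_0_iff flip: right_diff_distrib)
qed


text \<open>On the imaginary axis \<open>|E (i y)|\<^sup>2 = r\<^sub>0\<^sup>2 + y\<^sup>2 (r\<^sub>1\<^sup>2 - 2 r\<^sub>0 r\<^sub>2) + O(y\<^sup>3)\<close>, where \<open>r\<^sub>k = 1 / \<Gamma>(k + \<beta>)\<close>.\<close>

lemma ex_cmod_mittag_leffler_1_less:
  assumes "\<beta> > 1"
  shows "\<exists>z. cmod (mittag_leffler_1 \<beta> z) < mittag_leffler_1 \<beta> (Re z)"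
proof (rule ccontr)
  assume "\<not> ?thesis"
  hence ge: "mittag_leffler_1 \<beta> (Re z) \<le> cmod (mittag_leffler_1 \<beta> z)" for z
    by (auto simp: not_less)
  define r0 r1 r2 where "r0 = rGamma \<beta>" "r1 = rGamma (\<beta> + 1)" "r2 = rGamma (\<beta> + 2)"
  note r_defs = this
  have r: "r0 = \<beta> * r1" "r1 = (\<beta> + 1) * r2" "r2 > 0"
    using rGamma_Suc_shift[of \<beta> 0] rGamma_Suc_shift[of "\<beta> + 1" 0] assms
    by (simp_all add: r_defs add_ac rGamma_real_pos)
  define v where "v = (\<lambda>y::real. mittag_leffler_1 (\<beta> + 3) (\<i> * of_real y))"
  \<comment> \<open>With \<open>v\<close> as the remainder of order three, the real and imaginary
    parts of \<open>E (i y)\<close> are \<open>r0 + y\<^sup>2 * p y\<close> and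
    \<open>y * q y\<close>. Hence \<open>G y\<close> is the squared modulus minus
    \<open>r0\<^sup>2\<close>, divided by \<open>y\<^sup>2\<close>, in a form continuous at
    \<open>0\<close>.\<close>
  define p q where "p = (\<lambda>y. - r2 + y * Im (v y))" and "q = (\<lambda>y. r1 - y\<^sup>2 * Re (v y))"
  define G where "G = (\<lambda>y. 2 * r0 * p y + y\<^sup>2 * (p y)\<^sup>2 + (q y)\<^sup>2)"
  have v_cont: "isCont v 0"
    unfolding v_def using assms by (intro continuous_intros) auto
  have v_cont: "isCont (\<lambda>y. Re (v y)) 0" "isCont (\<lambda>y. Im (v y)) 0"
    using v_cont by (auto simp: isCont_def intro!: tendsto_Re tendsto_Im)
  have nonneg: "G y \<ge> 0" if "y > 0" for y
  proof -
    let ?z = "\<i> * complex_of_real y"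
    have E: "mittag_leffler_1 \<beta> ?z = of_real r0 + ?z * (of_real r1 + ?z * (of_real r2 + ?z * v y))"
      using assms mittag_leffler_1_shift[of \<beta> ?z] mittag_leffler_1_shift[of "\<beta> + 1" ?z]
        mittag_leffler_1_shift[of "\<beta> + 2" ?z] by (simp add: r_defs v_def add_ac)
    have ReIm: "Re (mittag_leffler_1 \<beta> ?z) = r0 + y\<^sup>2 * p y" "Im (mittag_leffler_1 \<beta> ?z) = y * q y"
      unfolding E by (simp_all add: p_def q_def algebra_simps power2_eq_square)
    have "(cmod (mittag_leffler_1 \<beta> ?z))\<^sup>2 = r0\<^sup>2 + y\<^sup>2 * G y"
      unfolding cmod_power2 ReIm by (simp add: G_def algebra_simps power2_eq_square)
    moreover have "r0\<^sup>2 \<le> (cmod (mittag_leffler_1 \<beta> ?z))\<^sup>2"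
      using ge[of ?z] r assms mittag_leffler_1_shift[of \<beta> "0::real"] by (intro power_mono) (simp_all add: r_defs)
    ultimately have "0 \<le> y\<^sup>2 * G y" by simp
    thus ?thesis using that by (simp add: zero_le_mult_iff)
  qed
  have "isCont G 0"
    unfolding G_def p_def q_def by (intro continuous_intros v_cont)
  hence "(G \<longlongrightarrow> G 0) (at_right 0)"
    unfolding isCont_def by (rule tendsto_mono[OF at_le[OF subset_UNIV]])
  hence "G 0 \<ge> 0"
    by (rule tendsto_lowerbound) (use eventually_at_right_less[of "0::real"] nonneg in \<open>auto elim: eventually_mono\<close>)
  moreover have "G 0 = - (\<beta> - 1) * (\<beta> + 1) * r2\<^sup>2"
    by (simp add: G_def p_def q_def r algebra_simps power2_eq_square)
  ultimately show False using assms r by (simp add: zero_le_mult_iff)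
qed

subsection \<open>Derivatives of the reciprocal\<close>

text \<open>This makes smoothness and Leibniz' rule for holomorphic functions available on the real
  line. The complex derivative can be computed along the real axis, where \<open>F\<close> is real,
  so its imaginary part is the derivative of zero.\<close>

lemma higher_deriv_of_real:
  fixes F :: "complex \<Rightarrow> complex" and g :: "real \<Rightarrow> real"
  assumes F: "F holomorphic_on S" "open S" and T: "open T" "\<And>x. x \<in> T \<Longrightarrow> of_real x \<in> S"
    and eq: "\<And>x. x \<in> T \<Longrightarrow> F (of_real x) = of_real (g x)" and "x \<in> T"
  shows "(deriv ^^ n) F (of_real x) = of_real ((deriv ^^ n) g x)"
    and "((deriv ^^ n) g has_real_derivative (deriv ^^ Suc n) g x) (at x)"
proof -
  have step: "((deriv ^^ n) g has_real_derivative (deriv ^^ Suc n) g x) (at x) \<and>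
       (deriv ^^ Suc n) F (of_real x) = of_real ((deriv ^^ Suc n) g x)"
    if IH: "\<And>x. x \<in> T \<Longrightarrow> (deriv ^^ n) F (of_real x) = of_real ((deriv ^^ n) g x)" and x: "x \<in> T" for n x
  proof -
    let ?D = "(deriv ^^ Suc n) F (of_real x)"
    have "((\<lambda>t. (deriv ^^ n) F (of_real t)) has_vector_derivative ?D) (at x)"
      using has_field_derivative_higher_deriv[OF F T(2)[OF x], of n]
      by (rule has_vector_derivative_real_field)
    hence D: "((\<lambda>t. complex_of_real ((deriv ^^ n) g t)) has_vector_derivative ?D) (at x)"
      by (rule has_vector_derivative_transform_within_open[OF _ T(1) x]) (rule IH)
    have "((deriv ^^ n) g has_vector_derivative Re ?D) (at x)"
      using bounded_linear.has_vector_derivative[OF bounded_linear_Re D] by simp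
    hence Re: "((deriv ^^ n) g has_real_derivative Re ?D) (at x)"
      by (simp add: has_real_derivative_iff_has_vector_derivative)
    have "((\<lambda>t. 0::real) has_vector_derivative Im ?D) (at x)"
      using bounded_linear.has_vector_derivative[OF bounded_linear_Im D] by simp
    hence "Im ?D = 0"
      using vector_derivative_unique_at[OF _ has_vector_derivative_const] by blast
    moreover have "(deriv ^^ Suc n) g x = Re ?D"
      using DERIV_imp_deriv[OF Re] by simp
    ultimately show ?thesis using Re by (metis complex_is_Real_iff of_real_Re)
  qed
  have *: "(deriv ^^ n) F (of_real x) = of_real ((deriv ^^ n) g x)" if "x \<in> T" for n x
    using that
  proof (induction n arbitrary: x)
    case 0
    thus ?case using eq by simp
  next
    case (Suc n)
    thus ?case using step by blast
  qed
  show "(deriv ^^ n) F (of_real x) = of_real ((deriv ^^ n) g x)"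
    by (rule *) fact
  show "((deriv ^^ n) g has_real_derivative (deriv ^^ Suc n) g x) (at x)"
    using step[OF *] \<open>x \<in> T\<close> by blast
qed

text \<open>With the sign built in, complete monotonicity of \<open>F\<close> becomes nonnegativity
  of all \<open>recip_ml \<beta> n\<close>, and the Leibniz recursion has nonnegative coefficients
  for \<beta> \<le> 1.\<close>

definition recip_ml :: "real \<Rightarrow> nat \<Rightarrow> real \<Rightarrow> real" where
  "recip_ml \<beta> n x = (-1) ^ n * (deriv ^^ n) (\<lambda>x. 1 / mittag_leffler_1 \<beta> x) x"

definition quot_ml :: "real \<Rightarrow> nat \<Rightarrow> real \<Rightarrow> real" where
  "quot_ml \<beta> n x = (-1) ^ n * (deriv ^^ n) (\<lambda>x. mittag_leffler_1 (\<beta> + 1) x / mittag_leffler_1 \<beta> x) x"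

lemma mittag_leffler_1_holomorphic [holomorphic_intros]:
  "\<beta> \<ge> 0 \<Longrightarrow> mittag_leffler_1 \<beta> holomorphic_on S"
  using has_field_derivative_mittag_leffler_1 by (metis holomorphic_on_def field_differentiable_def
      field_differentiable_at_within)

lemma open_mittag_leffler_1_nonzero:
  "\<beta> \<ge> 0 \<Longrightarrow> open {z :: 'a :: {real_normed_field, banach}. mittag_leffler_1 \<beta> z \<noteq> 0}"
  by (intro open_Collect_neq continuous_at_imp_continuous_on ballI continuous_intros) auto

text \<open>Requiring only that \<open>E\<close> is nonzero at \<open>x\<close> covers the point
  \<open>0\<close> for \<beta> > 0, where the induction starts and the Taylor coefficients are
  taken.\<close>

lemma higher_deriv_recip_quot_ml:
  fixes x :: real
  assumes \<beta>: "\<beta> \<ge> 0" and nz: "mittag_leffler_1 \<beta> x \<noteq> 0"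
  defines "F \<equiv> (\<lambda>z::complex. 1 / mittag_leffler_1 \<beta> z)"
    and "N \<equiv> (\<lambda>z::complex. mittag_leffler_1 (\<beta> + 1) z / mittag_leffler_1 \<beta> z)"
  shows "(deriv ^^ n) F (of_real x) = of_real ((-1) ^ n * recip_ml \<beta> n x)"
    and "(deriv ^^ n) N (of_real x) = of_real ((-1) ^ n * quot_ml \<beta> n x)"
    and "(recip_ml \<beta> n has_real_derivative - recip_ml \<beta> (Suc n) x) (at x)"
    and "(quot_ml \<beta> n has_real_derivative - quot_ml \<beta> (Suc n) x) (at x)"
proof -
  let ?S = "{z::complex. mittag_leffler_1 \<beta> z \<noteq> 0}" and ?T = "{x::real. mittag_leffler_1 \<beta> x \<noteq> 0}"
  have hol: "F holomorphic_on ?S" "N holomorphic_on ?S"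
    unfolding F_def N_def using \<beta> by (auto intro!: holomorphic_intros)
  have S: "open ?S" "open ?T" and sub: "\<And>x. x \<in> ?T \<Longrightarrow> complex_of_real x \<in> ?S" and x: "x \<in> ?T"
    using \<beta> nz by (auto intro: open_mittag_leffler_1_nonzero simp: mittag_leffler_1_of_real)
  have eq: "F (of_real x) = of_real (1 / mittag_leffler_1 \<beta> x)"
    "N (of_real x) = of_real (mittag_leffler_1 (\<beta> + 1) x / mittag_leffler_1 \<beta> x)" for x
    using \<beta> by (simp_all add: F_def N_def mittag_leffler_1_of_real)
  have F: "(deriv ^^ n) F (of_real x) = of_real ((deriv ^^ n) (\<lambda>x. 1 / mittag_leffler_1 \<beta> x) x)"
    "((deriv ^^ n) (\<lambda>x. 1 / mittag_leffler_1 \<beta> x) has_real_derivative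
      (deriv ^^ Suc n) (\<lambda>x. 1 / mittag_leffler_1 \<beta> x) x) (at x)" for n
    by (rule higher_deriv_of_real[OF hol(1) S]; (rule sub eq x | assumption)+)+
  have N: "(deriv ^^ n) N (of_real x) = of_real ((deriv ^^ n) (\<lambda>x. mittag_leffler_1 (\<beta> + 1) x / mittag_leffler_1 \<beta> x) x)"
    "((deriv ^^ n) (\<lambda>x. mittag_leffler_1 (\<beta> + 1) x / mittag_leffler_1 \<beta> x) has_real_derivative
      (deriv ^^ Suc n) (\<lambda>x. mittag_leffler_1 (\<beta> + 1) x / mittag_leffler_1 \<beta> x) x) (at x)" for n
    by (rule higher_deriv_of_real[OF hol(2) S]; (rule sub eq x | assumption)+)+
  show "(deriv ^^ n) F (of_real x) = of_real ((-1) ^ n * recip_ml \<beta> n x)"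
    "(deriv ^^ n) N (of_real x) = of_real ((-1) ^ n * quot_ml \<beta> n x)"
    by (simp_all add: F(1) N(1) recip_ml_def quot_ml_def flip: mult.assoc power_mult_distrib)
  show "(recip_ml \<beta> n has_real_derivative - recip_ml \<beta> (Suc n) x) (at x)"
    "(quot_ml \<beta> n has_real_derivative - quot_ml \<beta> (Suc n) x) (at x)"
    unfolding recip_ml_def quot_ml_def
    using DERIV_cmult[OF F(2)[of n], of "(-1) ^ n"] DERIV_cmult[OF N(2)[of n], of "(-1) ^ n"] by simp_all
qed

lemma recip_ml_0: "recip_ml \<beta> 0 x = 1 / mittag_leffler_1 \<beta> x"
  and quot_ml_0: "quot_ml \<beta> 0 x = mittag_leffler_1 (\<beta> + 1) x / mittag_leffler_1 \<beta> x"
  by (simp_all add: recip_ml_def quot_ml_def)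

text \<open>Leibniz' rule for \<open>- F' = F + (1 - \<beta>) F N\<close>, where \<open>F = 1 / E\<^sub>\<beta>\<close> and \<open>N = E\<^sub>\<beta>\<^sub>+\<^sub>1 / E\<^sub>\<beta>\<close>.\<close>

lemma recip_ml_Suc:
  assumes \<beta>: "\<beta> \<ge> 0" and nz: "mittag_leffler_1 \<beta> x \<noteq> 0"
  shows "recip_ml \<beta> (Suc n) x = recip_ml \<beta> n x +
    (1 - \<beta>) * (\<Sum>k\<le>n. real (n choose k) * recip_ml \<beta> k x * quot_ml \<beta> (n - k) x)"
proof -
  define F N :: "complex \<Rightarrow> complex"
    where "F = (\<lambda>z. 1 / mittag_leffler_1 \<beta> z)"
      and "N = (\<lambda>z. mittag_leffler_1 (\<beta> + 1) z / mittag_leffler_1 \<beta> z)"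
  let ?S = "{z::complex. mittag_leffler_1 \<beta> z \<noteq> 0}"
  have hol: "F holomorphic_on ?S" "N holomorphic_on ?S"
    unfolding F_def N_def using \<beta> by (auto intro!: holomorphic_intros)
  have S: "open ?S" by (rule open_mittag_leffler_1_nonzero[OF \<beta>])
  have x: "complex_of_real x \<in> ?S"
    using \<beta> nz by (simp add: mittag_leffler_1_of_real)
  note ders = higher_deriv_recip_quot_ml(1,2)[OF \<beta> nz, folded F_def N_def]
  have dF: "deriv F z = - F z - of_real (1 - \<beta>) * (F z * N z)" if "z \<in> ?S" for z
  proof (rule DERIV_imp_deriv)
    show "(F has_field_derivative - F z - of_real (1 - \<beta>) * (F z * N z)) (at z)"
      unfolding F_def N_def using that
      by (auto intro!: derivative_eq_intros has_field_derivative_mittag_leffler_1[OF \<beta>] simp: field_simps)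
  qed
  have FN: "(\<lambda>z. F z * N z) holomorphic_on ?S"
    by (rule holomorphic_on_mult[OF hol])
  have hol': "(\<lambda>z. - 1 * F z) holomorphic_on ?S" "(\<lambda>z. of_real (1 - \<beta>) * (F z * N z)) holomorphic_on ?S"
    by (rule holomorphic_on_mult[OF holomorphic_on_const] hol(1) FN)+
  have "(deriv ^^ Suc n) F (of_real x) = (deriv ^^ n) (deriv F) (of_real x)"
    by (simp only: funpow_Suc_right o_apply)
  also have "\<dots> = (deriv ^^ n) (\<lambda>z. - 1 * F z - of_real (1 - \<beta>) * (F z * N z)) (of_real x)"
    by (rule higher_deriv_transform_within_open[OF holomorphic_deriv[OF hol(1) S] holomorphic_on_diff[OF hol'] S x])
       (simp add: dF)
  also have "\<dots> = (deriv ^^ n) (\<lambda>z. - 1 * F z) (of_real x) -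
      (deriv ^^ n) (\<lambda>z. of_real (1 - \<beta>) * (F z * N z)) (of_real x)"
    by (rule higher_deriv_diff[OF hol' S x])
  also have "(deriv ^^ n) (\<lambda>z. - 1 * F z) (of_real x) = - 1 * (deriv ^^ n) F (of_real x)"
    by (rule higher_deriv_cmult[OF hol(1) x S])
  also have "(deriv ^^ n) (\<lambda>z. of_real (1 - \<beta>) * (F z * N z)) (of_real x) =
      of_real (1 - \<beta>) * (deriv ^^ n) (\<lambda>z. F z * N z) (of_real x)"
    by (rule higher_deriv_cmult[OF FN x S])
  also have "(deriv ^^ n) (\<lambda>z. F z * N z) (of_real x) =
      (\<Sum>k = 0..n. of_nat (n choose k) * (deriv ^^ k) F (of_real x) * (deriv ^^ (n - k)) N (of_real x))"
    by (rule higher_deriv_mult[OF hol S x])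
  also have "\<dots> = of_real ((-1) ^ n * (\<Sum>k\<le>n. real (n choose k) * recip_ml \<beta> k x * quot_ml \<beta> (n - k) x))"
  proof -
    have "of_nat (n choose k) * (deriv ^^ k) F (of_real x) * (deriv ^^ (n - k)) N (of_real x) =
        of_real ((-1) ^ n * (real (n choose k) * recip_ml \<beta> k x * quot_ml \<beta> (n - k) x))" if "k \<le> n" for k
    proof -
      have "(-1 :: real) ^ n = (-1) ^ k * (-1) ^ (n - k)"
        using that by (simp flip: power_add)
      thus ?thesis
        unfolding ders by (simp only: of_real_mult of_real_of_nat_eq mult_ac)
    qed
    thus ?thesis
      unfolding sum_distrib_left of_real_sum by (intro sum.cong) auto
  qed
  finally have "complex_of_real ((-1) ^ Suc n * recip_ml \<beta> (Suc n) x) = of_real ((-1) ^ Suc n *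
     (recip_ml \<beta> n x + (1 - \<beta>) * (\<Sum>k\<le>n. real (n choose k) * recip_ml \<beta> k x * quot_ml \<beta> (n - k) x)))"
    unfolding ders by (simp add: algebra_simps)
  hence "(-1) ^ Suc n * recip_ml \<beta> (Suc n) x = (-1) ^ Suc n *
     (recip_ml \<beta> n x + (1 - \<beta>) * (\<Sum>k\<le>n. real (n choose k) * recip_ml \<beta> k x * quot_ml \<beta> (n - k) x))"
    by (simp only: of_real_eq_iff)
  thus ?thesis by simp
qed

text \<open>Differentiate \<open>x N = 1 - r F\<close> repeatedly, \<open>n + 1\<close> times in
  all; on the left only two Leibniz terms survive.\<close>

lemma quot_ml_Suc:
  assumes \<beta>: "\<beta> \<ge> 0" and nz: "mittag_leffler_1 \<beta> x \<noteq> 0"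
  shows "x * quot_ml \<beta> (Suc n) x = real (Suc n) * quot_ml \<beta> n x - rGamma \<beta> * recip_ml \<beta> (Suc n) x"
proof -
  define T where "T = {x::real. mittag_leffler_1 \<beta> x \<noteq> 0}"
  have T: "open T" unfolding T_def by (rule open_mittag_leffler_1_nonzero[OF \<beta>])
  note der = higher_deriv_recip_quot_ml(3,4)[OF \<beta>]
  \<comment> \<open>The conditional term keeps the constant \<open>1\<close> at order zero; there
    the truncated index \<open>n - 1\<close> is multiplied by \<open>0\<close>.\<close>
  have key: "real n * quot_ml \<beta> (n - 1) x - rGamma \<beta> * recip_ml \<beta> n x + (if n = 0 then 1 else 0) = x * quot_ml \<beta> n x"
    if "x \<in> T" for n x
    using that
  proof (induction n arbitrary: x)
    case 0
    thus ?case
      using mittag_leffler_1_shift[OF \<beta>, of x] by (simp add: T_def recip_ml_0 quot_ml_0 field_simps)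
  next
    case (Suc n)
    have nz: "mittag_leffler_1 \<beta> x \<noteq> 0" using Suc.prems by (simp add: T_def)
    have "((\<lambda>x. real n * quot_ml \<beta> (n - 1) x - rGamma \<beta> * recip_ml \<beta> n x + (if n = 0 then 1 else 0))
       has_real_derivative real n * - quot_ml \<beta> (Suc (n - 1)) x - rGamma \<beta> * - recip_ml \<beta> (Suc n) x + 0) (at x)"
      by (intro DERIV_add DERIV_diff DERIV_cmult der nz DERIV_const)
    hence "((\<lambda>x. x * quot_ml \<beta> n x) has_real_derivative
        real n * - quot_ml \<beta> (Suc (n - 1)) x - rGamma \<beta> * - recip_ml \<beta> (Suc n) x + 0) (at x)"
      by (rule has_field_derivative_transform_within_open[OF _ T Suc.prems]) (rule Suc.IH)
    moreover have "((\<lambda>x. x * quot_ml \<beta> n x) has_real_derivative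
        1 * quot_ml \<beta> n x + - quot_ml \<beta> (Suc n) x * x) (at x)"
      by (intro DERIV_mult DERIV_ident der nz)
    ultimately have "real n * - quot_ml \<beta> (Suc (n - 1)) x - rGamma \<beta> * - recip_ml \<beta> (Suc n) x + 0
        = 1 * quot_ml \<beta> n x + - quot_ml \<beta> (Suc n) x * x"
      by (rule DERIV_unique)
    thus ?case by (cases n) (simp_all add: algebra_simps)
  qed
  from key[of x "Suc n"] nz show ?thesis by (simp add: T_def)
qed

subsection \<open>Complete monotonicity for \<open>\<beta> \<le> 1\<close>\<close>

text \<open>Only the summand \<open>k = 0\<close> of Leibniz' rule contains
  \<open>quot_ml \<beta> n\<close>, whose sign is still open. It is kept; all other summands are
  nonnegative and are dropped.\<close>

lemma recip_ml_Suc_ge: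
  assumes "\<beta> \<ge> 0" "\<beta> \<le> 1" "mittag_leffler_1 \<beta> x \<noteq> 0"
    and "\<And>k. k \<le> n \<Longrightarrow> recip_ml \<beta> k x \<ge> 0" "\<And>k. k < n \<Longrightarrow> quot_ml \<beta> k x \<ge> 0"
  shows "recip_ml \<beta> (Suc n) x \<ge> recip_ml \<beta> n x + (1 - \<beta>) * (recip_ml \<beta> 0 x * quot_ml \<beta> n x)"
proof -
  let ?g = "\<lambda>k. real (n choose k) * recip_ml \<beta> k x * quot_ml \<beta> (n - k) x"
  have "?g 0 \<le> (\<Sum>k\<le>n. ?g k)"
    using assms(4,5) by (intro member_le_sum) auto
  hence "(1 - \<beta>) * ?g 0 \<le> (1 - \<beta>) * (\<Sum>k\<le>n. ?g k)"
    using assms by (intro mult_left_mono) auto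
  thus ?thesis
    unfolding recip_ml_Suc[OF assms(1,3)] by simp
qed

text \<open>By \<open>quot_ml_Suc\<close>, \<open>s ^ (n + 1) * quot_ml \<beta> n s\<close> has
  derivative \<open>r * s ^ n * recip_ml \<beta> (n + 1) s\<close>, and it vanishes at
  \<open>0\<close>. Thus positivity strictly before \<open>x\<close> suffices.\<close>

lemma quot_ml_pos_if_recip_ml_pos:
  assumes "\<beta> > 0" "x > 0" and pos: "\<And>s. 0 < s \<Longrightarrow> s < x \<Longrightarrow> recip_ml \<beta> (Suc n) s > 0"
  shows "quot_ml \<beta> n x > 0"
proof -
  have \<beta>: "\<beta> \<ge> 0" using assms by simp
  have nz: "mittag_leffler_1 \<beta> s \<noteq> 0" if "s \<ge> 0" for s :: real
    using mittag_leffler_1_pos[OF assms(1) that] by simp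
  let ?A = "\<lambda>s. s ^ Suc n * quot_ml \<beta> n s"
  have A': "(?A has_real_derivative rGamma \<beta> * s ^ n * recip_ml \<beta> (Suc n) s) (at s)" if "s \<ge> 0" for s
  proof -
    have "(?A has_real_derivative real (Suc n) * s ^ n * quot_ml \<beta> n s + - quot_ml \<beta> (Suc n) s * s ^ Suc n) (at s)"
      using DERIV_mult[OF DERIV_pow[of "Suc n"] higher_deriv_recip_quot_ml(4)[OF \<beta> nz[OF that], of n]] by simp
    also have "real (Suc n) * s ^ n * quot_ml \<beta> n s + - quot_ml \<beta> (Suc n) s * s ^ Suc n =
        s ^ n * (real (Suc n) * quot_ml \<beta> n s - s * quot_ml \<beta> (Suc n) s)"
      by (simp add: algebra_simps)
    also have "\<dots> = rGamma \<beta> * s ^ n * recip_ml \<beta> (Suc n) s"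
      using quot_ml_Suc[OF \<beta> nz[OF that], of n] by simp
    finally show ?thesis .
  qed
  have "?A 0 < ?A x"
  proof (rule DERIV_pos_imp_increasing_open[OF assms(2)])
    fix s assume s: "0 < s" "s < x"
    have "rGamma \<beta> * s ^ n * recip_ml \<beta> (Suc n) s > 0"
      using s assms by (intro mult_pos_pos pos rGamma_real_pos) auto
    thus "\<exists>y. (?A has_real_derivative y) (at s) \<and> y > 0"
      using A'[of s] s by auto
  next
    show "continuous_on {0..x} ?A"
      by (intro continuous_at_imp_continuous_on ballI DERIV_isCont[OF A']) simp
  qed
  hence "x ^ Suc n * quot_ml \<beta> n x > 0" by simp
  thus ?thesis using assms(2) by (rule zero_less_mult_pos[OF _ zero_less_power])
qed

text \<open>If \<open>recip_ml \<beta> (n + 1)\<close> had a first zero \<open>t\<close>, then \<open>quot_ml \<beta> n t > 0\<close> by positivity on \<open>(0, t)\<close>,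
  and Leibniz' rule would give \<open>recip_ml \<beta> (n + 1) t > 0\<close>.\<close>

lemma recip_ml_pos_quot_ml_pos:
  assumes "\<beta> > 0" "\<beta> \<le> 1"
  shows "(\<forall>k\<le>n. \<forall>x\<ge>0. recip_ml \<beta> k x > 0) \<and> (\<forall>k<n. \<forall>x\<ge>0. quot_ml \<beta> k x > 0)"
proof (induction n)
  case 0
  show ?case using mittag_leffler_1_pos[OF assms(1)] by (simp add: recip_ml_0)
next
  case (Suc n)
  have \<beta>: "\<beta> \<ge> 0" using assms by simp
  have nz: "mittag_leffler_1 \<beta> x \<noteq> 0" if "x \<ge> 0" for x :: real
    using mittag_leffler_1_pos[OF assms(1) that] by simp
  have r0: "rGamma \<beta> > 0" using assms by (intro rGamma_real_pos)
  let ?F = "recip_ml \<beta> (Suc n)"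
  have lower: "?F x > (1 - \<beta>) * (recip_ml \<beta> 0 x * quot_ml \<beta> n x)" if "x \<ge> 0" for x
  proof -
    have "recip_ml \<beta> n x + (1 - \<beta>) * (recip_ml \<beta> 0 x * quot_ml \<beta> n x) \<le> ?F x"
      using Suc.IH that by (intro recip_ml_Suc_ge \<beta> assms(2) nz) (auto intro: less_imp_le)
    moreover have "recip_ml \<beta> n x > 0" using Suc.IH that by blast
    ultimately show ?thesis by linarith
  qed
  have quot0: "quot_ml \<beta> n 0 = rGamma \<beta> * ?F 0 / real (Suc n)"
    using quot_ml_Suc[OF \<beta> nz[of 0], of n] by (simp add: field_simps)
  \<comment> \<open>At \<open>0\<close> the lower bound involves \<open>?F 0\<close> itself, with
    coefficient \<open>(1 - \<beta>) / (n + 1)\<close>. As \<beta> > 0 this is below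
    \<open>1\<close>, so the term can be absorbed.\<close>
  have F0: "?F 0 > 0"
  proof -
    have "recip_ml \<beta> 0 0 = 1 / rGamma \<beta>"
      using mittag_leffler_1_shift[OF \<beta>, of "0::real"] by (simp add: recip_ml_0)
    hence "(1 - \<beta>) * (recip_ml \<beta> 0 0 * quot_ml \<beta> n 0) = (1 - \<beta>) / real (Suc n) * ?F 0"
      using r0 by (simp add: quot0)
    hence "(1 - (1 - \<beta>) / real (Suc n)) * ?F 0 > 0"
      using lower[of 0] by (simp add: left_diff_distrib)
    moreover have "(1 - \<beta>) / real (Suc n) < 1"
      using assms by (simp add: field_simps)
    ultimately show ?thesis by (simp add: zero_less_mult_iff)
  qed
  have F: "?F x > 0" if x: "x \<ge> 0" for x
  proof (rule ccontr)
    assume "\<not> ?F x > 0"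
    \<comment> \<open>The least element of this compact set is the first point where positivity
      fails; \<open>F0\<close> keeps it away from \<open>0\<close>.\<close>
    define Z where "Z = {0..x} \<inter> ?F -` {..0}"
    have "continuous_on {0..x} ?F"
      by (rule continuous_at_imp_continuous_on) (auto intro: DERIV_isCont[OF higher_deriv_recip_quot_ml(3)[OF \<beta> nz]])
    hence "closed Z"
      unfolding Z_def by (intro continuous_closed_preimage) auto
    moreover have "bounded Z" unfolding Z_def by (intro bounded_Int) auto
    moreover have "x \<in> Z" using x \<open>\<not> ?F x > 0\<close> by (simp add: Z_def)
    ultimately obtain t where t: "t \<in> Z" "\<And>s. s \<in> Z \<Longrightarrow> t \<le> s"
      using compact_attains_inf[of Z] by (auto simp: compact_eq_bounded_closed)
    have "t > 0" using t(1) F0 by (cases "t = 0") (auto simp: Z_def)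
    moreover have "?F s > 0" if "0 < s" "s < t" for s
      by (rule ccontr) (use t(1) t(2)[of s] that in \<open>auto simp: Z_def\<close>)
    ultimately have "quot_ml \<beta> n t > 0"
      using quot_ml_pos_if_recip_ml_pos[OF assms(1)] by blast
    moreover have "recip_ml \<beta> 0 t > 0" using Suc.IH \<open>t > 0\<close> by simp
    ultimately have "(1 - \<beta>) * (recip_ml \<beta> 0 t * quot_ml \<beta> n t) \<ge> 0"
      using assms by simp
    hence "?F t > 0" using lower[of t] \<open>t > 0\<close> by linarith
    thus False using t(1) by (simp add: Z_def)
  qed
  have "quot_ml \<beta> n x > 0" if "x \<ge> 0" for x
  proof (cases "x = 0")
    case True
    thus ?thesis using F0 r0 by (simp add: quot0)
  next
    case False
    thus ?thesis using quot_ml_pos_if_recip_ml_pos[OF assms(1)] F that by simp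
  qed
  with F Suc.IH show ?case by (auto simp: le_Suc_eq less_Suc_eq)
qed

text \<open>Here \<open>N\<close> is \<open>1 / x\<close>; since \<open>rGamma 0 = 0\<close>, the
  recursion for \<open>quot_ml\<close> no longer involves \<open>recip_ml\<close>.\<close>

lemma quot_ml_0_pos:
  assumes "x > 0"
  shows "quot_ml 0 n x > 0"
proof (induction n)
  case 0
  show ?case
    using assms mittag_leffler_1_pos[of 1 x] by (simp add: quot_ml_0 mittag_leffler_1_0)
next
  case (Suc n)
  have "x * quot_ml 0 (Suc n) x = real (Suc n) * quot_ml 0 n x"
    using quot_ml_Suc[of 0 x n] assms by (simp add: mittag_leffler_1_0)
  with Suc have "x * quot_ml 0 (Suc n) x > 0" by simp
  thus ?case using assms by (simp add: zero_less_mult_iff)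
qed

text \<open>For \<beta> = 0 the reciprocal has a pole at \<open>0\<close>, but every
  \<open>quot_ml\<close> is already known to be positive, so a plain induction on the order replaces
  the first-zero argument.\<close>

lemma recip_ml_nonneg:
  assumes "\<beta> \<ge> 0" "\<beta> \<le> 1" "x > 0"
  shows "recip_ml \<beta> n x \<ge> 0"
proof (cases "\<beta> = 0")
  case False
  thus ?thesis using recip_ml_pos_quot_ml_pos[of \<beta> n] assms by (simp add: less_imp_le)
next
  case True
  show ?thesis
  proof (induction n rule: less_induct)
    case (less n)
    have nz: "mittag_leffler_1 \<beta> x > 0" using assms True by (simp add: mittag_leffler_1_0)
    show ?case
    proof (cases n)
      case 0
      thus ?thesis using nz by (simp add: recip_ml_0)
    next
      case (Suc m)
      have "recip_ml \<beta> m x + (1 - \<beta>) * (recip_ml \<beta> 0 x * quot_ml \<beta> m x) \<le> recip_ml \<beta> (Suc m) x"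
        using less Suc nz quot_ml_0_pos[OF assms(3)] assms True
        by (intro recip_ml_Suc_ge) (auto intro: less_imp_le)
      moreover have "recip_ml \<beta> m x + (1 - \<beta>) * (recip_ml \<beta> 0 x * quot_ml \<beta> m x) \<ge> 0"
        using less[of m] less[of 0] Suc quot_ml_0_pos[OF assms(3), of m] assms True
        by (intro add_nonneg_nonneg mult_nonneg_nonneg) auto
      ultimately show ?thesis using Suc by simp
    qed
  qed
qed

lemma mittag_leffler_1_pos':
  assumes "\<beta> \<ge> 0" "x > (0::real)"
  shows "mittag_leffler_1 \<beta> x > 0"
  using assms mittag_leffler_1_pos[of \<beta> x] by (cases "\<beta> = 0") (simp_all add: mittag_leffler_1_0)

lemma completely_monotone_recip_mittag_leffler_1:
  assumes "\<beta> \<ge> 0" "\<beta> \<le> 1"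
  shows "completely_monotone (\<lambda>x. 1 / mittag_leffler_1 \<beta> x)"
proof -
  have "(deriv ^^ n) (\<lambda>x. 1 / mittag_leffler_1 \<beta> x) differentiable (at x)" if "x > 0" for n and x :: real
  proof -
    have "mittag_leffler_1 \<beta> x \<noteq> 0" using mittag_leffler_1_pos'[OF assms(1) that] by simp
    hence "(\<lambda>x. (-1) ^ n * recip_ml \<beta> n x) differentiable (at x)"
      using higher_deriv_recip_quot_ml(3)[OF assms(1)]
      by (intro differentiable_mult differentiable_const) (auto simp: real_differentiable_def)
    thus ?thesis by (simp add: recip_ml_def flip: mult.assoc power_mult_distrib)
  qed
  thus ?thesis
    using recip_ml_nonneg[OF assms] mittag_leffler_1_pos'[OF assms(1)]
    by (simp add: completely_monotone_def recip_ml_def)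
qed

subsection \<open>Failure of complete monotonicity for \<open>\<beta> > 1\<close>\<close>

text \<open>With \<open>g(s) = \<Sum> c\<^sub>n s\<^sup>n\<close> and \<open>h(s) = \<Sum> c\<^sub>n\<^sub>+\<^sub>1 s\<^sup>n\<close>, the recursion bounds the coefficients of \<open>B g h\<close> by those
  of \<open>g\<close>. Both series are entire, so \<open>h \<le> 1 / B\<close>, while \<open>h(s) \<ge> c\<^sub>1 + c\<^sub>2 s\<close> is unbounded.\<close>

lemma no_nonneg_riccati_coefficients:
  fixes c :: "nat \<Rightarrow> real"
  assumes nonneg: "\<And>n. c n \<ge> 0" and c0: "c 0 > 0" and B: "B > 0"
    and rec: "\<And>n. real (Suc n) * c (Suc n) = c n - B * (\<Sum>k\<le>n. c k * c (Suc (n - k)))"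
  shows False
proof -
  \<comment> \<open>The recursion is implicit, as its summand \<open>k = 0\<close> contains
    \<open>c (Suc n)\<close>; that term is moved to the left. It follows that
    \<open>1 - B * c 1\<close> is the inverse of \<open>1 + B * c 0\<close>, whence
    \<open>c 2 > 0\<close>.\<close>
  have c1: "c 1 * (1 + B * c 0) = c 0"
    using rec[of 0] by (simp add: algebra_simps)
  have "c 1 \<noteq> 0" using c1 c0 by auto
  hence "c 1 > 0" using nonneg[of 1] by simp
  have "c 2 * (2 + B * c 0) = c 1 * (1 - B * c 1)"
    using rec[of 1] by (simp add: numeral_2_eq_2 algebra_simps)
  moreover have "(1 - B * c 1) * (1 + B * c 0) = 1"
    using arg_cong[OF c1, of "(*) B"] by (simp add: algebra_simps)
  hence "1 - B * c 1 > 0"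
    using c0 B by (intro zero_less_mult_pos2[of "1 - B * c 1" "1 + B * c 0"]) (simp_all add: add_pos_pos)
  ultimately have "c 2 * (2 + B * c 0) > 0" using \<open>c 1 > 0\<close> by simp
  hence "c 2 > 0" using c0 B by (intro zero_less_mult_pos2[of "c 2" "2 + B * c 0"]) (simp_all add: add_pos_pos)
  \<comment> \<open>Dropping the nonnegative convolution gives factorial decay of the coefficients,
    hence convergence at every \<open>s\<close>.\<close>
  have dec: "real (Suc n) * c (Suc n) \<le> c n" for n
  proof -
    have "B * (\<Sum>k\<le>n. c k * c (Suc (n - k))) \<ge> 0"
      using B by (intro mult_nonneg_nonneg sum_nonneg nonneg) simp
    thus ?thesis using rec[of n] by linarith
  qed
  have c_le: "c n \<le> c 0 / fact n" for n
  proof (induction n)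
    case (Suc n)
    have "c (Suc n) \<le> c n / real (Suc n)" using dec[of n] by (simp add: field_simps)
    also have "\<dots> \<le> c 0 / fact n / real (Suc n)" by (intro divide_right_mono Suc.IH) simp
    finally show ?case by (simp add: mult_ac)
  qed simp
  have d_le: "c (Suc n) \<le> c n" for n
    using dec[of n] mult_right_mono[of 1 "real (Suc n)" "c (Suc n)"] nonneg[of "Suc n"] by simp
  \<comment> \<open>Chosen so that \<open>B * c 2 * s = 1\<close>: then
    \<open>B * (c 1 + c 2 * s) = B * c 1 + 1\<close> exceeds the bound \<open>1\<close> for
    \<open>B * h\<close>.\<close>
  define s where "s = 1 / (B * c 2)"
  have "s > 0" using B \<open>c 2 > 0\<close> by (simp add: s_def)
  have sum_c: "summable (\<lambda>n. norm (c n * s ^ n))"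
  proof (rule summable_comparison_test')
    show "summable (\<lambda>n. c 0 * (inverse (fact n) * s ^ n))"
      by (intro summable_mult summable_exp)
    show "norm (norm (c n * s ^ n)) \<le> c 0 * (inverse (fact n) * s ^ n)" for n
      using mult_right_mono[OF c_le[of n], of "s ^ n"] nonneg[of n] \<open>s > 0\<close>
      by (simp add: abs_mult divide_inverse mult_ac)
  qed
  have sum_d: "summable (\<lambda>n. norm (c (Suc n) * s ^ n))"
  proof (rule summable_comparison_test'[OF sum_c])
    show "norm (norm (c (Suc n) * s ^ n)) \<le> norm (c n * s ^ n)" for n
      using d_le[of n] nonneg \<open>s > 0\<close> by (simp add: abs_mult mult_right_mono)
  qed
  note sum_c' = summable_norm_cancel[OF sum_c] and sum_d' = summable_norm_cancel[OF sum_d]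
  define g h where "g = (\<Sum>n. c n * s ^ n)" and "h = (\<Sum>n. c (Suc n) * s ^ n)"
  have prod: "(\<lambda>n. \<Sum>k\<le>n. c k * s ^ k * (c (Suc (n - k)) * s ^ (n - k))) sums (g * h)"
    unfolding g_def h_def by (rule Cauchy_product_sums[OF sum_c sum_d])
  \<comment> \<open>Coefficientwise, this is the recursion without its nonnegative left-hand
    side.\<close>
  have "B * (g * h) \<le> g"
  proof (rule sums_le)
    show "(\<lambda>n. B * (\<Sum>k\<le>n. c k * s ^ k * (c (Suc (n - k)) * s ^ (n - k)))) sums (B * (g * h))"
      by (intro sums_mult prod)
    show "(\<lambda>n. c n * s ^ n) sums g"
      unfolding g_def by (rule summable_sums[OF sum_c'])
    fix n
    have "(\<Sum>k\<le>n. c k * s ^ k * (c (Suc (n - k)) * s ^ (n - k))) = (\<Sum>k\<le>n. c k * c (Suc (n - k))) * s ^ n"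
      unfolding sum_distrib_right
    proof (intro sum.cong refl)
      fix k assume "k \<in> {..n}"
      hence "s ^ n = s ^ k * s ^ (n - k)" by (simp flip: power_add)
      thus "c k * s ^ k * (c (Suc (n - k)) * s ^ (n - k)) = c k * c (Suc (n - k)) * s ^ n" by simp
    qed
    moreover have "B * (\<Sum>k\<le>n. c k * c (Suc (n - k))) \<le> c n"
      using rec[of n] mult_nonneg_nonneg[OF of_nat_0_le_iff nonneg[of "Suc n"], of "Suc n"] by linarith
    ultimately show "B * (\<Sum>k\<le>n. c k * s ^ k * (c (Suc (n - k)) * s ^ (n - k))) \<le> c n * s ^ n"
      using \<open>s > 0\<close> by (simp add: mult_right_mono flip: mult.assoc)
  qed
  moreover have "g > 0"
  proof -
    have "0 < (\<Sum>n<1. c n * s ^ n)" using c0 by simp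
    also have "\<dots> \<le> g"
      unfolding g_def using nonneg \<open>s > 0\<close> by (intro sum_le_suminf sum_c') auto
    finally show ?thesis .
  qed
  ultimately have "B * h \<le> 1"
    by (intro mult_right_le_imp_le[of "B * h" g 1]) (simp_all add: mult_ac)
  moreover have "(\<Sum>n<2. c (Suc n) * s ^ n) \<le> h"
    unfolding h_def using nonneg \<open>s > 0\<close> by (intro sum_le_suminf sum_d') auto
  hence "c 1 + c 2 * s \<le> h" by (simp add: numeral_2_eq_2)
  hence "B * (c 1 + c 2 * s) \<le> B * h" using B by (intro mult_left_mono) auto
  ultimately have "B * c 1 + 1 \<le> 1"
    using B \<open>c 2 > 0\<close> by (simp add: s_def distrib_left)
  thus False using mult_pos_pos[OF B \<open>c 1 > 0\<close>] by linarith
qed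

text \<open>The signs on \<open>(0, \<infinity>)\<close> pass to \<open>0\<close> by continuity. At
  \<open>0\<close>, \<open>quot_ml_Suc\<close> expresses \<open>quot_ml\<close> through
  \<open>recip_ml\<close>, so Leibniz' rule becomes the excluded recursion with
  \<open>B = (\<beta> - 1) * rGamma \<beta>\<close>.\<close>

lemma not_completely_monotone_recip_mittag_leffler_1:
  assumes "\<beta> > 1"
  shows "\<not> completely_monotone (\<lambda>x. 1 / mittag_leffler_1 \<beta> x)"
proof
  assume "completely_monotone (\<lambda>x. 1 / mittag_leffler_1 \<beta> x)"
  hence pos: "recip_ml \<beta> n x \<ge> 0" if "x > 0" for n x
    using that by (simp add: completely_monotone_def recip_ml_def)
  have \<beta>: "\<beta> \<ge> 0" using assms by simp
  have r0: "rGamma \<beta> > 0" using assms by (intro rGamma_real_pos) simp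
  have E0: "mittag_leffler_1 \<beta> 0 = rGamma \<beta>"
    using mittag_leffler_1_shift[OF \<beta>, of "0::real"] by simp
  have nz: "mittag_leffler_1 \<beta> (0::real) \<noteq> 0" using E0 r0 by simp
  \<comment> \<open>These are the Taylor coefficients at \<open>0\<close> of
    \<open>F (- s)\<close>.\<close>
  define c where "c = (\<lambda>n. recip_ml \<beta> n 0 / fact n)"
  have c_nonneg: "c n \<ge> 0" for n
  proof -
    have "(recip_ml \<beta> n \<longlongrightarrow> recip_ml \<beta> n 0) (at_right 0)"
      using DERIV_isCont[OF higher_deriv_recip_quot_ml(3)[OF \<beta> nz]]
      unfolding isCont_def by (rule tendsto_mono[OF at_le[OF subset_UNIV]])
    hence "recip_ml \<beta> n 0 \<ge> 0"
      by (rule tendsto_lowerbound) (use eventually_at_right_less[of "0::real"] pos in \<open>auto elim: eventually_mono\<close>)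
    thus ?thesis by (simp add: c_def)
  qed
  have recip: "recip_ml \<beta> n 0 = c n * fact n" for n
    by (simp add: c_def)
  have quot: "quot_ml \<beta> n 0 = rGamma \<beta> * c (Suc n) * fact n" for n
  proof -
    have "c (Suc n) * fact n = recip_ml \<beta> (Suc n) 0 / real (Suc n)"
      by (simp add: c_def)
    moreover have "quot_ml \<beta> n 0 = rGamma \<beta> * (recip_ml \<beta> (Suc n) 0 / real (Suc n))"
      using quot_ml_Suc[OF \<beta> nz, of n] by (simp add: field_simps)
    ultimately show ?thesis by (simp only: mult.assoc)
  qed
  have rec: "real (Suc n) * c (Suc n) = c n - (\<beta> - 1) * rGamma \<beta> * (\<Sum>k\<le>n. c k * c (Suc (n - k)))" for n
  proof -
    have "(\<Sum>k\<le>n. real (n choose k) * recip_ml \<beta> k 0 * quot_ml \<beta> (n - k) 0) =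
        (\<Sum>k\<le>n. fact n * rGamma \<beta> * (c k * c (Suc (n - k))))"
    proof (intro sum.cong refl)
      fix k assume "k \<in> {..n}"
      hence "real (n choose k) = fact n / (fact k * fact (n - k))"
        by (intro binomial_fact) simp
      thus "real (n choose k) * recip_ml \<beta> k 0 * quot_ml \<beta> (n - k) 0 = fact n * rGamma \<beta> * (c k * c (Suc (n - k)))"
        by (simp add: quot recip)
    qed
    hence "recip_ml \<beta> (Suc n) 0 = recip_ml \<beta> n 0 + (1 - \<beta>) * (fact n * rGamma \<beta> * (\<Sum>k\<le>n. c k * c (Suc (n - k))))"
      using recip_ml_Suc[OF \<beta> nz, of n] by (simp add: sum_distrib_left)
    moreover have "recip_ml \<beta> (Suc n) 0 = fact n * (real (Suc n) * c (Suc n))" "recip_ml \<beta> n 0 = fact n * c n"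
      by (simp_all add: c_def)
    ultimately have "fact n * (real (Suc n) * c (Suc n)) =
        fact n * (c n - (\<beta> - 1) * rGamma \<beta> * (\<Sum>k\<le>n. c k * c (Suc (n - k))))"
      by (simp add: algebra_simps)
    thus ?thesis by (simp only: mult_cancel_left fact_nonzero simp_thms)
  qed
  have "c 0 > 0" "(\<beta> - 1) * rGamma \<beta> > 0"
    using r0 E0 assms by (simp_all add: c_def recip_ml_0)
  thus False
    using no_nonneg_riccati_coefficients c_nonneg rec by blast
qed

theorem mainTheorem8:
  fixes \<beta> :: real
  assumes "\<beta> \<ge> 0"
  shows "((\<forall>z::complex. cmod (mittag_leffler_1 \<beta> z) \<ge> mittag_leffler_1 \<beta> (Re z)) \<longleftrightarrow> \<beta> \<le> 1) \<and>
         (\<beta> \<le> 1 \<longleftrightarrow> completely_monotone (\<lambda>x. 1 / mittag_leffler_1 \<beta> x))"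
proof -
  have "mittag_leffler_1 \<beta> (Re z) \<le> cmod (mittag_leffler_1 \<beta> z)" if "\<beta> \<le> 1" for z
  \<comment> \<open>For \<beta> = 0, \<open>E\<close> is \<open>z * exp z\<close>, and both sides
    share the factor \<open>exp (Re z)\<close>.\<close>
  proof (cases "\<beta> = 0")
    case True
    have "Re z \<le> cmod z" by (rule complex_Re_le_cmod)
    thus ?thesis using True by (simp add: mittag_leffler_1_0 norm_mult)
  next
    case False
    thus ?thesis using assms that by (intro mittag_leffler_1_Re_le_cmod) auto
  qed
  moreover have "\<beta> \<le> 1" if "\<forall>z. cmod (mittag_leffler_1 \<beta> z) \<ge> mittag_leffler_1 \<beta> (Re z)"
    using that ex_cmod_mittag_leffler_1_less[of \<beta>] by (meson not_le)
  ultimately show ?thesis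
    using completely_monotone_recip_mittag_leffler_1[OF assms]
      not_completely_monotone_recip_mittag_leffler_1[of \<beta>] by (meson not_le)
qed

end
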